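(* Let $G$ be an arbitrary subgroup of $\Gamma=\mathrm{PSL}_2(\mathbb{Z})$. We have $\mathrm{Aut}(Y_{\mathrm{comb}}(G))=N_\Gamma(G)/G$.
   Context: $N_\Gamma(G)$ is the normaliser of $G$ in $\Gamma$; it acts on the set $G\backslash\Gamma$ of cosets $Gx$ by $n\cdot Gx=Gnx$, commuting with the right action of $\Gamma$. Let $G_0,G_1\subset\Gamma$ be the subgroups of order 2 and 3 generated by the classes of $\left(\begin{smallmatrix}0&-1\\1&0\end{smallmatrix}\right)$ and $u=\left(\begin{smallmatrix}0&1\\-1&1\end{smallmatrix}\right)$. $Y_{\mathrm{comb}}(G)$ is the graph (multiple edges allowed) whose vertices of type (0), respectively (1), are the $G_0$-orbits, respectively $G_1$-orbits, in the right $\Gamma$-set $G\backslash\Gamma$, and whose edge set is $G\backslash\Gamma$, the edge $x$ joining the $G_0$-orbit of $x$ with the $G_1$-orbit of $x$. Vertices of type (0) have valency 1 or 2, vertices of type (1) have valency 1 or 3, and the edges at a trivalent vertex of type (1) are cyclically ordered as $x,xu,xu^2$. $\mathrm{Aut}(Y_{\mathrm{comb}}(G))$ is the group of graph automorphisms (compatible bijections of edges and vertices) preserving the types of the vertices and the cyclic orders. The equality means that the groups are identified via the action above. *)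

theory Defs
  imports "HOL-Analysis.Determinants" "HOL-Algebra.Algebra"
begin

type_synonym mat2 = "int ^ 2 ^ 2"

definition SL2Z :: "mat2 monoid" where
  "SL2Z = \<lparr>carrier = {A. det A = 1}, mult = (\<lambda>A B. A ** B), one = mat 1\<rparr>"

definition PSL2Z :: "mat2 set monoid" where
  "PSL2Z = SL2Z Mod {mat 1, - mat 1}"

definition psl_class :: "mat2 \<Rightarrow> mat2 set" where
  "psl_class A = {mat 1, - mat 1} #>\<^bsub>SL2Z\<^esub> A"

(* "vector" lists the rows of a matrix. *)
definition psl_s :: "mat2 set" where
  "psl_s = psl_class (vector [vector [0, -1], vector [1, 0]])"

definition psl_u :: "mat2 set" where
  "psl_u = psl_class (vector [vector [0, 1], vector [-1, 1]])"

definition G0 :: "mat2 set set" where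
  "G0 = generate PSL2Z {psl_s}"

definition G1 :: "mat2 set set" where
  "G1 = generate PSL2Z {psl_u}"

(* Multigraphs with typed vertices: "ends" gives the set of end points of an edge, so that
   parallel edges are allowed.  "cyc" gives, for each vertex, the cyclic order on the edges
   at this vertex as a ternary relation, empty where no cyclic order is prescribed. *)
record ('v, 'e) cyc_graph =
  verts :: "'v set"
  edges :: "'e set"
  ends :: "'e \<Rightarrow> 'v set"
  vtype :: "'v \<Rightarrow> nat"
  cyc :: "'v \<Rightarrow> ('e \<times> 'e \<times> 'e) set"

definition graph_auts :: "('v, 'e) cyc_graph \<Rightarrow> (('e \<Rightarrow> 'e) \<times> ('v \<Rightarrow> 'v)) set" where
  "graph_auts Y = {(f, h). f \<in> Bij (edges Y) \<and> h \<in> Bij (verts Y) \<and>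
     (\<forall>e \<in> edges Y. ends Y (f e) = h ` ends Y e) \<and>
     (\<forall>v \<in> verts Y. vtype Y (h v) = vtype Y v) \<and>
     (\<forall>v \<in> verts Y. \<forall>a \<in> edges Y. \<forall>b \<in> edges Y. \<forall>c \<in> edges Y.
        (a, b, c) \<in> cyc Y v \<longleftrightarrow> (f a, f b, f c) \<in> cyc Y (h v))}"

definition Aut :: "('v, 'e) cyc_graph \<Rightarrow> (('e \<Rightarrow> 'e) \<times> ('v \<Rightarrow> 'v)) monoid" where
  "Aut Y = (BijGroup (edges Y) \<times>\<times> BijGroup (verts Y)) \<lparr>carrier := graph_auts Y\<rparr>"

(* The orbit of C under the right action of a subgroup H on cosets. *)
definition right_orbit :: "mat2 set set \<Rightarrow> mat2 set set \<Rightarrow> mat2 set set set" where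
  "right_orbit H C = {C #>\<^bsub>PSL2Z\<^esub> h | h. h \<in> H}"

(* An orbit is tagged with its type because the same set of cosets can be both a G0-orbit
   and a G1-orbit. *)
type_synonym comb_vertex = "nat \<times> mat2 set set set"

definition vertex0 :: "mat2 set set \<Rightarrow> comb_vertex" where
  "vertex0 C = (0, right_orbit G0 C)"

definition vertex1 :: "mat2 set set \<Rightarrow> comb_vertex" where
  "vertex1 C = (1, right_orbit G1 C)"

definition Y_comb :: "mat2 set set \<Rightarrow> (comb_vertex, mat2 set set) cyc_graph" where
  "Y_comb G =
    \<lparr>verts = vertex0 ` (rcosets\<^bsub>PSL2Z\<^esub> G) \<union> vertex1 ` (rcosets\<^bsub>PSL2Z\<^esub> G),
     edges = rcosets\<^bsub>PSL2Z\<^esub> G,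
     ends = (\<lambda>x. {vertex0 x, vertex1 x}),
     vtype = fst,
     cyc = (\<lambda>(i, Q). if i = 1 \<and> card Q = 3
              then {(x, x #>\<^bsub>PSL2Z\<^esub> psl_u, x #>\<^bsub>PSL2Z\<^esub> (psl_u [^]\<^bsub>PSL2Z\<^esub> (2::nat))) | x. x \<in> Q}
              else {})\<rparr>"

end

theory Submission
  imports Defs
begin

text \<open>A bijection of the set of cosets \<open>Gx\<close> comes from a graph automorphism iff it commutes with the right
  action of the classes of \<open>s\<close> and \<open>u\<close>: preserving the vertices of type 0 amounts to commuting with
  \<open>s\<close>, whose orbits have at most two elements, and preserving the vertices of type 1 together with
  their cyclic orders amounts to commuting with \<open>u\<close>. Since \<open>s\<close> and \<open>u\<close> generate \<open>\<Gamma>\<close>, the automorphisms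
  are the \<open>\<Gamma>\<close>-equivariant bijections of this set, and these are the maps \<open>Gx \<mapsto> Gnx\<close> with \<open>n\<close> in the
  normaliser of \<open>G\<close>.\<close>

section \<open>Integer 2 by 2 matrices and the groups \<open>SL2Z\<close> and
  \<open>PSL2Z\<close>\<close>

abbreviation mk2 :: "int \<Rightarrow> int \<Rightarrow> int \<Rightarrow> int \<Rightarrow> mat2" where
  "mk2 a b c d \<equiv> vector [vector [a, b], vector [c, d]]"

lemma mk2_cases: obtains a b c d where "A = mk2 a b c d"
proof
  show "A = mk2 (A$1$1) (A$1$2) (A$2$1) (A$2$2)"
    by (simp add: vec_eq_iff forall_2)
qed

lemma mk2_mult:
  "mk2 a b c d ** mk2 a' b' c' d' =
    mk2 (a * a' + b * c') (a * b' + b * d') (c * a' + d * c') (c * b' + d * d')"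
  by (simp add: vec_eq_iff forall_2 matrix_matrix_mult_def sum_2)

lemma det_mk2: "det (mk2 a b c d) = a * d - b * c"
  by (simp add: det_2)

lemma mk2_minus: "- mk2 a b c d = mk2 (- a) (- b) (- c) (- d)"
  by (simp add: vec_eq_iff forall_2)

lemma mk2_one: "mat 1 = mk2 1 0 0 1"
  by (simp add: vec_eq_iff forall_2 mat_def)

lemma det_minus_mat2: "det (- A) = det (A :: mat2)"
  by (simp add: det_2)

lemma minus_mat2_mult: "- A ** B = - (A ** B)" "A ** - B = - (A ** B)" for A B :: mat2
  by (simp_all add: vec_eq_iff forall_2 matrix_matrix_mult_def sum_2)

lemma SL2Z_simps:
  "carrier SL2Z = {A. det A = 1}" "A \<otimes>\<^bsub>SL2Z\<^esub> B = A ** B" "\<one>\<^bsub>SL2Z\<^esub> = mat 1"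
  by (simp_all add: SL2Z_def)

interpretation SL2Z: group SL2Z
proof (rule groupI)
  fix A :: mat2 assume "A \<in> carrier SL2Z"
  moreover obtain a b c d where "A = mk2 a b c d" by (rule mk2_cases)
  \<comment> \<open>The inverse of a matrix of determinant 1 is its adjugate.\<close>
  ultimately have "mk2 d (- b) (- c) a \<in> carrier SL2Z"
    "mk2 d (- b) (- c) a \<otimes>\<^bsub>SL2Z\<^esub> A = \<one>\<^bsub>SL2Z\<^esub>"
    by (auto simp: SL2Z_simps det_mk2 mk2_mult mk2_one algebra_simps)
  then show "\<exists>B\<in>carrier SL2Z. B \<otimes>\<^bsub>SL2Z\<^esub> A = \<one>\<^bsub>SL2Z\<^esub>" by blast
qed (auto simp: SL2Z_simps det_mul matrix_mul_assoc)

text \<open>The two elements are their own inverses and commute with every matrix, so left and right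
  cosets agree.\<close>

interpretation center: normal "{mat 1, - mat 1}" SL2Z
proof (rule SL2Z.normalI)
  have inv: "inv\<^bsub>SL2Z\<^esub> A = A" if "A \<in> {mat 1, - mat 1}" for A
    using that by (intro SL2Z.inv_equality) (auto simp: SL2Z_simps det_minus_mat2 minus_mat2_mult)
  show "subgroup {mat 1, - mat 1} SL2Z"
  proof (rule SL2Z.subgroupI)
    show "{mat 1, - mat 1} \<subseteq> carrier SL2Z" by (simp add: SL2Z_simps det_minus_mat2)
    show "{mat 1, - mat 1 :: mat2} \<noteq> {}" by simp
  next
    fix A assume "A \<in> {mat 1, - mat 1 :: mat2}"
    then show "inv\<^bsub>SL2Z\<^esub> A \<in> {mat 1, - mat 1}" by (simp add: inv)
  next
    fix A B assume "A \<in> {mat 1, - mat 1 :: mat2}" "B \<in> {mat 1, - mat 1 :: mat2}"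
    then show "A \<otimes>\<^bsub>SL2Z\<^esub> B \<in> {mat 1, - mat 1}"
      by (elim insertE emptyE) (simp_all add: SL2Z_simps minus_mat2_mult)
  qed
qed (auto simp: r_coset_def l_coset_def SL2Z_simps minus_mat2_mult)

interpretation PSL2Z: group PSL2Z
  unfolding PSL2Z_def by (rule center.factorgroup_is_group)

lemma psl_class_eq: "psl_class A = {A, - A}"
  by (auto simp: psl_class_def r_coset_def SL2Z_simps minus_mat2_mult)

lemma psl_class_minus: "psl_class (- A) = psl_class A"
  by (auto simp: psl_class_eq)

lemma psl_class_closed: "det A = 1 \<Longrightarrow> psl_class A \<in> carrier PSL2Z"
  by (auto simp: psl_class_def PSL2Z_def FactGroup_def RCOSETS_def SL2Z_simps)

lemma psl_class_cases:
  assumes "K \<in> carrier PSL2Z"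
  obtains A where "det A = 1" "K = psl_class A"
  using assms by (auto simp: psl_class_def PSL2Z_def FactGroup_def RCOSETS_def SL2Z_simps)

lemma psl_class_mult:
  "det A = 1 \<Longrightarrow> det B = 1 \<Longrightarrow> psl_class (A ** B) = psl_class A \<otimes>\<^bsub>PSL2Z\<^esub> psl_class B"
  using hom_mult[OF center.r_coset_hom_Mod, of A B] by (simp add: psl_class_def PSL2Z_def SL2Z_simps)

lemma psl_class_one: "psl_class (mat 1) = \<one>\<^bsub>PSL2Z\<^esub>"
  by (simp add: psl_class_eq PSL2Z_def)

section \<open>Relations and generation for s and u\<close>

lemma psl_s_closed [simp]: "psl_s \<in> carrier PSL2Z"
  and psl_u_closed [simp]: "psl_u \<in> carrier PSL2Z"
  by (auto simp: psl_s_def psl_u_def det_mk2 intro!: psl_class_closed)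

text \<open>In \<open>SL2Z\<close> the square of s and the cube of u both equal
  \<open>- mat 1\<close>, which is trivial in the quotient. These relations make \<open>G0\<close>
  and \<open>G1\<close>, and hence their orbits, explicit.\<close>

lemma psl_s_square: "psl_s \<otimes>\<^bsub>PSL2Z\<^esub> psl_s = \<one>\<^bsub>PSL2Z\<^esub>"
proof -
  have "psl_s \<otimes>\<^bsub>PSL2Z\<^esub> psl_s = psl_class (- mat 1)"
    unfolding psl_s_def by (subst psl_class_mult[symmetric]) (simp_all add: det_mk2 mk2_mult mk2_one mk2_minus)
  then show ?thesis by (simp add: psl_class_minus psl_class_one)
qed

lemma psl_u_cube: "psl_u \<otimes>\<^bsub>PSL2Z\<^esub> (psl_u \<otimes>\<^bsub>PSL2Z\<^esub> psl_u) = \<one>\<^bsub>PSL2Z\<^esub>"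
proof -
  have "psl_u \<otimes>\<^bsub>PSL2Z\<^esub> (psl_u \<otimes>\<^bsub>PSL2Z\<^esub> psl_u) = psl_class (- mat 1)"
    unfolding psl_u_def
    by (simp add: psl_class_mult[symmetric] det_mk2 mk2_mult mk2_one mk2_minus)
  then show ?thesis by (simp add: psl_class_minus psl_class_one)
qed

text \<open>The unit translation is \<open>u u s\<close> and its inverse is \<open>s u\<close>;
  induction over the integers in both directions yields all powers. They perform the division steps
  of the Euclidean algorithm.\<close>

lemma psl_class_translation:
  "psl_class (mk2 1 m 0 1) \<in> generate PSL2Z {psl_s, psl_u}" (is "_ \<in> ?H")
proof -
  interpret H: subgroup ?H PSL2Z by (rule PSL2Z.generate_is_subgroup) simp
  have gens: "psl_s \<in> ?H" "psl_u \<in> ?H" by (auto intro: generate.incl)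
  have fwd: "psl_class (mk2 1 1 0 1) = psl_u \<otimes>\<^bsub>PSL2Z\<^esub> psl_u \<otimes>\<^bsub>PSL2Z\<^esub> psl_s"
    unfolding psl_u_def psl_s_def by (simp add: psl_class_mult[symmetric] det_mk2 mk2_mult)
  have bwd: "psl_class (mk2 1 (- 1) 0 1) = psl_s \<otimes>\<^bsub>PSL2Z\<^esub> psl_u"
    unfolding psl_u_def psl_s_def by (simp add: psl_class_mult[symmetric] det_mk2 mk2_mult)
  have plus: "psl_class (mk2 1 (i + j) 0 1) = psl_class (mk2 1 i 0 1) \<otimes>\<^bsub>PSL2Z\<^esub> psl_class (mk2 1 j 0 1)" for i j
    by (simp add: psl_class_mult[symmetric] det_mk2 mk2_mult add.commute)
  show ?thesis
  proof (induction m rule: int_induct[where k = 0])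
    case base
    then show ?case by (simp add: mk2_one[symmetric] psl_class_one)
  next
    case (step1 i)
    then show ?case by (simp add: plus fwd gens)
  next
    case (step2 i)
    then show ?case using plus[of i "- 1"] by (simp add: bwd gens)
  qed
qed

text \<open>The Euclidean algorithm on the first column.\<close>

lemma psl_class_generated:
  "a * d - b * c = 1 \<Longrightarrow> psl_class (mk2 a b c d) \<in> generate PSL2Z {psl_s, psl_u}"
  (is "_ \<Longrightarrow> _ \<in> ?H")
proof (induction "nat \<bar>c\<bar>" arbitrary: a b c d rule: less_induct)
  case less
  interpret H: subgroup ?H PSL2Z by (rule PSL2Z.generate_is_subgroup) simp
  show ?case
  proof (cases "c = 0")
    case True
    with less.prems have "a * d = 1" by simp
    then consider "a = 1" "d = 1" | "a = - 1" "d = - 1" by (auto simp: zmult_eq_1_iff)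
    then show ?thesis
    proof cases
      case 1
      then show ?thesis using True psl_class_translation by simp
    next
      case 2
      \<comment> \<open>The matrix is a translation up to sign, and the quotient ignores the
        sign.\<close>
      then have "mk2 a b c d = - mk2 1 (- b) 0 1" using True by (simp add: mk2_minus)
      then show ?thesis using psl_class_translation[of "- b"] by (simp only: psl_class_minus)
    qed
  next
    case False
    define q where "q = a div c"
    have qc: "q * c - a = - (a mod c)"
      by (simp add: q_def minus_mod_eq_div_mult[symmetric])
    have det: "c * (q * d - b) - d * (q * c - a) = 1"
      using less.prems by (simp add: algebra_simps)
    have "\<bar>q * c - a\<bar> < \<bar>c\<bar>" using abs_mod_less[OF False, of a] by (simp add: qc)
    then have "psl_class (mk2 c d (q * c - a) (q * d - b)) \<in> ?H"
      using det False by (intro less.hyps) auto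
    moreover have "psl_s \<in> ?H" by (auto intro: generate.incl)
    \<comment> \<open>Stripping the translation by \<open>q\<close> from the left replaces
      \<open>a\<close> by \<open>a mod c\<close>; stripping s then exchanges the rows up to sign, so
      that the negated remainder becomes the lower left entry, on which the induction runs.\<close>
    moreover have "psl_class (mk2 a b c d) = psl_class (mk2 1 q 0 1) \<otimes>\<^bsub>PSL2Z\<^esub>
        (psl_s \<otimes>\<^bsub>PSL2Z\<^esub> psl_class (mk2 c d (q * c - a) (q * d - b)))"
    proof -
      have "mk2 a b c d = mk2 1 q 0 1 ** (mk2 0 (- 1) 1 0 ** mk2 c d (q * c - a) (q * d - b))"
        by (simp add: mk2_mult algebra_simps)
      moreover have "det (mk2 c d (q * c - a) (q * d - b)) = 1" using det by (simp only: det_mk2)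
      ultimately show ?thesis unfolding psl_s_def
        by (simp only: psl_class_mult[symmetric] det_mul) (simp add: psl_class_mult det_mul det_mk2)
    qed
    ultimately show ?thesis using psl_class_translation by simp
  qed
qed

lemma PSL2Z_generated: "carrier PSL2Z = generate PSL2Z {psl_s, psl_u}"
proof
  show "carrier PSL2Z \<subseteq> generate PSL2Z {psl_s, psl_u}"
  proof
    fix K assume "K \<in> carrier PSL2Z"
    then obtain A where A: "det A = 1" "K = psl_class A" by (rule psl_class_cases)
    obtain a b c d where "A = mk2 a b c d" by (rule mk2_cases)
    with A show "K \<in> generate PSL2Z {psl_s, psl_u}" by (simp add: psl_class_generated det_mk2)
  qed
qed (simp add: PSL2Z.generate_incl)

lemma G0_eq: "G0 = {\<one>\<^bsub>PSL2Z\<^esub>, psl_s}"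
proof
  have inv: "inv\<^bsub>PSL2Z\<^esub> psl_s = psl_s"
    by (rule PSL2Z.inv_equality) (simp_all add: psl_s_square)
  show "G0 \<subseteq> {\<one>\<^bsub>PSL2Z\<^esub>, psl_s}"
  proof
    fix g assume "g \<in> G0"
    then show "g \<in> {\<one>\<^bsub>PSL2Z\<^esub>, psl_s}" unfolding G0_def
    proof induction
      case (eng g h)
      then show ?case by (elim insertE emptyE) (simp_all add: psl_s_square)
    qed (simp_all add: inv)
  qed
qed (auto simp: G0_def intro: generate.intros)

lemma G1_eq: "G1 = {\<one>\<^bsub>PSL2Z\<^esub>, psl_u, psl_u \<otimes>\<^bsub>PSL2Z\<^esub> psl_u}"
proof
  have cube: "psl_u \<otimes>\<^bsub>PSL2Z\<^esub> psl_u \<otimes>\<^bsub>PSL2Z\<^esub> psl_u = \<one>\<^bsub>PSL2Z\<^esub>"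
    by (simp add: PSL2Z.m_assoc psl_u_cube)
  have inv: "inv\<^bsub>PSL2Z\<^esub> psl_u = psl_u \<otimes>\<^bsub>PSL2Z\<^esub> psl_u"
    by (rule PSL2Z.inv_equality) (simp_all add: cube)
  have fourth: "psl_u \<otimes>\<^bsub>PSL2Z\<^esub> psl_u \<otimes>\<^bsub>PSL2Z\<^esub> (psl_u \<otimes>\<^bsub>PSL2Z\<^esub> psl_u) = psl_u"
    by (simp add: PSL2Z.m_assoc psl_u_cube)
  show "G1 \<subseteq> {\<one>\<^bsub>PSL2Z\<^esub>, psl_u, psl_u \<otimes>\<^bsub>PSL2Z\<^esub> psl_u}"
  proof
    fix g assume "g \<in> G1"
    then show "g \<in> {\<one>\<^bsub>PSL2Z\<^esub>, psl_u, psl_u \<otimes>\<^bsub>PSL2Z\<^esub> psl_u}" unfolding G1_def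
    proof induction
      case (eng g h)
      then show ?case
        by (elim insertE emptyE) (simp_all add: psl_u_cube cube fourth)
    qed (simp_all add: inv)
  qed
qed (auto simp: G1_def intro: generate.intros)

section \<open>Normalisers and equivariant maps on the cosets of a subgroup, in any group\<close>

context group
begin

text \<open>The library defines \<open>normalizer\<close> as the stabiliser of \<open>H\<close>
  under conjugation of subsets. Multiplying by \<open>n\<close> or \<open>inv n\<close> on the right
  passes to the form without inverses.\<close>

lemma normalizer_iff:
  assumes "subgroup H G"
  shows "n \<in> normalizer G H \<longleftrightarrow> n \<in> carrier G \<and> n <# H = H #> n"
proof -
  have H: "H \<subseteq> carrier G" using assms by (rule subgroup.subset)
  have "n <# H #> inv n = H \<longleftrightarrow> n <# H = H #> n" if n: "n \<in> carrier G"
  proof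
    assume "n <# H #> inv n = H"
    then have "n <# H #> inv n #> n = H #> n" by simp
    then show "n <# H = H #> n"
      using n H by (simp add: coset_mult_assoc l_coset_subset_G coset_mult_one)
  next
    assume "n <# H = H #> n"
    then show "n <# H #> inv n = H" using n H by (simp add: coset_mult_assoc coset_mult_one)
  qed
  then show ?thesis using H by (auto simp: normalizer_def stabilizer_def)
qed

text \<open>Since nH = Hn, the inner factors can be exchanged: HnHx = HHnx = Hnx.\<close>

lemma set_mult_rcoset_normalizer:
  assumes H: "subgroup H G" and n: "n \<in> normalizer G H" and x: "x \<in> carrier G"
  shows "(H #> n) <#> (H #> x) = H #> (n \<otimes> x)"
proof -
  have nG: "n \<in> carrier G" and nH: "n <# H = H #> n" using n normalizer_iff[OF H] by auto
  have HG: "H \<subseteq> carrier G" using H by (rule subgroup.subset)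
  have "(H #> n) <#> (H #> x) = H <#> (H #> n) #> x"
    using HG nG x by (simp add: setmult_rcos_assoc rcos_assoc_lcos nH r_coset_subset_G)
  also have "\<dots> = H #> (n \<otimes> x)"
    using HG nG x by (simp add: setmult_rcos_assoc subgroup_mult_id[OF H] coset_mult_assoc)
  finally show ?thesis .
qed

lemma rcoset_eq_iff:
  assumes "subgroup H G" "x \<in> carrier G" "y \<in> carrier G"
  shows "H #> x = H #> y \<longleftrightarrow> x \<otimes> inv y \<in> H"
  using assms by (metis coset_join1 coset_join2 coset_mult_inv1 coset_mult_inv2 inv_closed m_closed subgroup.subset)

text \<open>A right-equivariant map on the cosets is determined by the image \<open>Hn\<close> of \<open>H\<close>; well-definedness
  forces \<open>n H n\<^sup>-\<^sup>1 \<subseteq> H\<close> and injectivity the converse inclusion.\<close>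

lemma equivariant_Bij_normalizer:
  assumes H: "subgroup H G" and f: "f \<in> Bij (rcosets H)"
    and eq: "\<And>C g. C \<in> rcosets H \<Longrightarrow> g \<in> carrier G \<Longrightarrow> f (C #> g) = f C #> g"
  obtains n where "n \<in> normalizer G H" "\<And>x. x \<in> carrier G \<Longrightarrow> f (H #> x) = H #> (n \<otimes> x)"
proof -
  have HG: "H \<subseteq> carrier G" using H by (rule subgroup.subset)
  have HX: "H \<in> rcosets H" using H by (rule subgroup.subgroup_in_rcosets[OF _ is_group])
  have "f H \<in> rcosets H" using f HX by (auto dest: Bij_imp_funcset)
  then obtain n where n: "n \<in> carrier G" "f H = H #> n" by (auto simp: RCOSETS_def)
  have act: "f (H #> x) = H #> (n \<otimes> x)" if "x \<in> carrier G" for x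
    using eq[OF HX that] that n HG by (simp add: coset_mult_assoc)
  have conj: "h \<in> H \<longleftrightarrow> n \<otimes> h \<otimes> inv n \<in> H" if h: "h \<in> carrier G" for h
  proof -
    have "h \<in> H \<longleftrightarrow> H #> h = H" using H h coset_join1 coset_join2 by blast
    also have "\<dots> \<longleftrightarrow> f (H #> h) = f H"
      using f HX rcosetsI[OF HG h] by (auto simp: Bij_def bij_betw_def inj_on_eq_iff)
    also have "\<dots> \<longleftrightarrow> n \<otimes> h \<otimes> inv n \<in> H" using h n H by (simp add: act rcoset_eq_iff)
    finally show ?thesis .
  qed
  have "n <# H = H #> n"
  proof (intro equalityI subsetI)
    fix y assume "y \<in> n <# H"
    then obtain h where h: "h \<in> H" "y = n \<otimes> h" by (auto simp: l_coset_def)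
    then have "h \<in> carrier G" using HG by auto
    then have "y = n \<otimes> h \<otimes> inv n \<otimes> n" using h n by (simp add: m_assoc)
    then show "y \<in> H #> n" using h conj \<open>h \<in> carrier G\<close> by (auto simp: r_coset_def)
  next
    fix y assume "y \<in> H #> n"
    then obtain h where h: "h \<in> H" "y = h \<otimes> n" by (auto simp: r_coset_def)
    then have hG: "h \<in> carrier G" using HG by auto
    \<comment> \<open>For the reverse inclusion, \<open>conj\<close> is applied to
      \<open>inv n \<otimes> h \<otimes> n\<close>, whose conjugate by \<open>n\<close> is
      \<open>h\<close>.\<close>
    have "n \<otimes> (inv n \<otimes> h \<otimes> n) \<otimes> inv n = h"
      using hG n by (simp add: m_assoc[symmetric]) (simp add: m_assoc)
    then have "inv n \<otimes> h \<otimes> n \<in> H" using h hG n conj[of "inv n \<otimes> h \<otimes> n"] by simp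
    moreover have "y = n \<otimes> (inv n \<otimes> h \<otimes> n)" using h hG n by (simp add: m_assoc[symmetric])
    ultimately show "y \<in> n <# H" by (auto simp: l_coset_def)
  qed
  then have "n \<in> normalizer G H" using n normalizer_iff[OF H] by simp
  then show thesis using act by (rule that)
qed

lemma set_mult_normalizer_Bij:
  assumes H: "subgroup H G" and n: "n \<in> normalizer G H"
  shows "(\<lambda>C\<in>rcosets H. (H #> n) <#> C) \<in> Bij (rcosets H)"
proof -
  have nG: "n \<in> carrier G" and HG: "H \<subseteq> carrier G"
    using n normalizer_iff[OF H] H subgroup.subset by auto
  have "bij_betw (\<lambda>C. (H #> n) <#> C) (rcosets H) (rcosets H)"
    unfolding bij_betw_def
  proof
    show "inj_on ((<#>) (H #> n)) (rcosets H)"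
    proof (rule inj_onI)
      fix C D assume "C \<in> rcosets H" "D \<in> rcosets H" and e: "(H #> n) <#> C = (H #> n) <#> D"
      then obtain x y where xy: "x \<in> carrier G" "y \<in> carrier G" "C = H #> x" "D = H #> y"
        by (auto simp: RCOSETS_def)
      \<comment> \<open>As Hnx = nHx, multiplying a coset by Hn is the same as translating it by
        \<open>n\<close> on the left, which \<open>inv n\<close> undoes.\<close>
      then have "n <# (H #> x) = n <# (H #> y)"
        using e n H HG nG normalizer_iff[OF H, of n]
        by (simp add: set_mult_rcoset_normalizer coset_assoc coset_mult_assoc)
      then have "inv n <# (n <# (H #> x)) = inv n <# (n <# (H #> y))" by simp
      then show "C = D" using xy nG HG by (simp add: lcos_m_assoc r_coset_subset_G lcos_mult_one)
    qed
    show "(<#>) (H #> n) ` (rcosets H) = rcosets H"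
    proof (intro equalityI subsetI)
      fix C assume "C \<in> (<#>) (H #> n) ` (rcosets H)"
      then show "C \<in> rcosets H"
        using nG HG H n by (auto simp: RCOSETS_def set_mult_rcoset_normalizer)
    next
      fix C assume "C \<in> rcosets H"
      then obtain x where x: "x \<in> carrier G" "C = H #> x" by (auto simp: RCOSETS_def)
      then have "C = (H #> n) <#> (H #> (inv n \<otimes> x))"
        using nG H n by (simp add: set_mult_rcoset_normalizer m_assoc[symmetric])
      then show "C \<in> (<#>) (H #> n) ` (rcosets H)" using x nG HG by (auto intro: rcosetsI)
    qed
  qed
  then show ?thesis by (simp add: Bij_def cong: bij_betw_cong)
qed

text \<open>Induction over the words in \<open>S\<close>. It reduces equivariance under the whole
  group to commuting with s and u.\<close>

lemma equivariant_generate: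
  assumes H: "subgroup H G" and f: "f \<in> rcosets H \<rightarrow> rcosets H" and S: "S \<subseteq> carrier G"
    and eq: "\<And>C g. C \<in> rcosets H \<Longrightarrow> g \<in> S \<Longrightarrow> f (C #> g) = f C #> g"
    and g: "g \<in> generate G S" and C: "C \<in> rcosets H"
  shows "f (C #> g) = f C #> g"
proof -
  have sub: "D \<subseteq> carrier G" if "D \<in> rcosets H" for D
    using H that subgroup.rcosets_carrier[OF _ is_group] by blast
  have mem: "D #> k \<in> rcosets H" if "D \<in> rcosets H" "k \<in> carrier G" for D k
    using that subgroup.subset[OF H] by (auto simp: RCOSETS_def coset_mult_assoc)
  show ?thesis using g C
  proof (induction arbitrary: C)
    case one
    then show ?case using f sub by (simp add: coset_mult_one Pi_iff)
  next
    case (incl h)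
    then show ?case by (intro eq)
  next
    case (inv h)
    then have h: "h \<in> carrier G" using S by auto
    let ?D = "C #> inv h"
    have D: "?D \<in> rcosets H" using inv h by (simp add: mem)
    \<comment> \<open>The inverse is handled by using the hypothesis for \<open>h\<close> at
      \<open>C #> inv h\<close>, whose translate by \<open>h\<close> is \<open>C\<close>.\<close>
    have "f (?D #> h) = f ?D #> h" using D inv by (intro eq)
    then have "f C = f ?D #> h" using inv h sub by (simp add: coset_mult_assoc coset_mult_one)
    then show ?case using h D f sub by (simp add: coset_mult_assoc coset_mult_one Pi_iff)
  next
    case (eng g h)
    then have gh: "g \<in> carrier G" "h \<in> carrier G" using generate_incl[OF S] by auto
    have "f (C #> g #> h) = f C #> g #> h" using eng gh by (simp add: mem)
    then show ?case using eng.prems gh sub f by (simp add: coset_mult_assoc Pi_iff)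
  qed
qed

end

section \<open>Orbits of \<open>G0\<close> and \<open>G1\<close> as vertices, and the vertex map
  induced by an edge map\<close>

definition equivariant :: "mat2 set set \<Rightarrow> (mat2 set set \<Rightarrow> mat2 set set) \<Rightarrow> bool" where
  "equivariant G f \<longleftrightarrow> (\<forall>C\<in>rcosets\<^bsub>PSL2Z\<^esub> G. \<forall>g\<in>carrier PSL2Z.
     f (C #>\<^bsub>PSL2Z\<^esub> g) = f C #>\<^bsub>PSL2Z\<^esub> g)"

text \<open>A vertex is a tagged set of edges, so an edge map acts on it by direct image. The
  restriction to the vertex set is there because members of \<open>Bij\<close> are
  extensional.\<close>

definition vertex_map ::
  "mat2 set set \<Rightarrow> (mat2 set set \<Rightarrow> mat2 set set) \<Rightarrow> comb_vertex \<Rightarrow> comb_vertex" where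
  "vertex_map G f = (\<lambda>v\<in>verts (Y_comb G). (fst v, f ` snd v))"

lemma Y_comb_simps:
  "verts (Y_comb G) = vertex0 ` (rcosets\<^bsub>PSL2Z\<^esub> G) \<union> vertex1 ` (rcosets\<^bsub>PSL2Z\<^esub> G)"
  "edges (Y_comb G) = rcosets\<^bsub>PSL2Z\<^esub> G"
  "ends (Y_comb G) C = {vertex0 C, vertex1 C}"
  "vtype (Y_comb G) v = fst v"
  by (simp_all add: Y_comb_def)

lemma cyc_vertex0: "cyc (Y_comb G) (vertex0 C) = {}"
  by (simp add: Y_comb_def vertex0_def)

lemma cyc_vertex1:
  "(a, b, c) \<in> cyc (Y_comb G) (vertex1 C) \<longleftrightarrow>
     card (right_orbit G1 C) = 3 \<and> a \<in> right_orbit G1 C \<and> b = a #>\<^bsub>PSL2Z\<^esub> psl_u \<and>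
     c = a #>\<^bsub>PSL2Z\<^esub> (psl_u \<otimes>\<^bsub>PSL2Z\<^esub> psl_u)"
  by (auto simp: Y_comb_def vertex1_def numeral_2_eq_2)

lemma G0_carrier: "G0 \<subseteq> carrier PSL2Z" and G1_carrier: "G1 \<subseteq> carrier PSL2Z"
  by (simp_all add: G0_def G1_def PSL2Z.generate_incl)

context
  fixes G :: "mat2 set set"
  assumes G: "subgroup G PSL2Z"
begin

abbreviation "cosets \<equiv> rcosets\<^bsub>PSL2Z\<^esub> G"

lemma coset_carrier: "C \<in> cosets \<Longrightarrow> C \<subseteq> carrier PSL2Z"
  using subgroup.rcosets_carrier[OF G PSL2Z.is_group] by blast

lemma coset_closed: "C \<in> cosets \<Longrightarrow> g \<in> carrier PSL2Z \<Longrightarrow> C #>\<^bsub>PSL2Z\<^esub> g \<in> cosets"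
  using subgroup.subset[OF G] by (auto simp: RCOSETS_def PSL2Z.coset_mult_assoc)

lemma coset_mult:
  "C \<in> cosets \<Longrightarrow> g \<in> carrier PSL2Z \<Longrightarrow> h \<in> carrier PSL2Z \<Longrightarrow>
    C #>\<^bsub>PSL2Z\<^esub> g #>\<^bsub>PSL2Z\<^esub> h = C #>\<^bsub>PSL2Z\<^esub> (g \<otimes>\<^bsub>PSL2Z\<^esub> h)"
  by (simp add: coset_carrier PSL2Z.coset_mult_assoc)

lemma coset_one: "C \<in> cosets \<Longrightarrow> C #>\<^bsub>PSL2Z\<^esub> \<one>\<^bsub>PSL2Z\<^esub> = C"
  by (simp add: coset_carrier PSL2Z.coset_mult_one)

lemma orbit_subset: "C \<in> cosets \<Longrightarrow> K \<subseteq> carrier PSL2Z \<Longrightarrow> right_orbit K C \<subseteq> cosets"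
  by (auto simp: right_orbit_def coset_closed)

lemma orbit_G0: "C \<in> cosets \<Longrightarrow> right_orbit G0 C = {C, C #>\<^bsub>PSL2Z\<^esub> psl_s}"
  unfolding right_orbit_def Setcompr_eq_image by (simp add: G0_eq coset_one)

lemma orbit_G1:
  "C \<in> cosets \<Longrightarrow>
    right_orbit G1 C = {C, C #>\<^bsub>PSL2Z\<^esub> psl_u, C #>\<^bsub>PSL2Z\<^esub> (psl_u \<otimes>\<^bsub>PSL2Z\<^esub> psl_u)}"
  unfolding right_orbit_def Setcompr_eq_image by (simp add: G1_eq coset_one)

lemma vertex0_act_s: "C \<in> cosets \<Longrightarrow> vertex0 (C #>\<^bsub>PSL2Z\<^esub> psl_s) = vertex0 C"
  by (auto simp: vertex0_def orbit_G0 coset_closed coset_mult psl_s_square coset_one)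

lemma vertex1_act_u:
  assumes C: "C \<in> cosets"
  shows "vertex1 (C #>\<^bsub>PSL2Z\<^esub> psl_u) = vertex1 C"
proof -
  have "C #>\<^bsub>PSL2Z\<^esub> psl_u #>\<^bsub>PSL2Z\<^esub> (psl_u \<otimes>\<^bsub>PSL2Z\<^esub> psl_u) = C"
    using C by (simp add: coset_mult psl_u_cube coset_one)
  then show ?thesis
    using C by (auto simp: vertex1_def orbit_G1 coset_closed coset_mult)
qed

lemma vertex0_eqD: "vertex0 C = vertex0 D \<Longrightarrow> C \<in> cosets \<Longrightarrow> C \<in> right_orbit G0 D"
  by (auto simp: vertex0_def orbit_G0)

lemma vertex1_eqD: "vertex1 C = vertex1 D \<Longrightarrow> C \<in> cosets \<Longrightarrow> C \<in> right_orbit G1 D"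
  by (auto simp: vertex1_def orbit_G1)

text \<open>If Cu differs from C, then C, Cu and Cuu are distinct: by uuu = 1, translating a
  coincidence with Cuu by u would give Cu = C. This settles the univalent vertices, where
  \<open>cyc\<close> is empty and says nothing about u.\<close>

lemma orbit_G1_degenerate:
  assumes C: "C \<in> cosets" and card: "card (right_orbit G1 C) \<noteq> 3"
  shows "C #>\<^bsub>PSL2Z\<^esub> psl_u = C"
proof (rule ccontr)
  let ?u = "psl_u" and ?v = "psl_u \<otimes>\<^bsub>PSL2Z\<^esub> psl_u"
  assume u: "C #>\<^bsub>PSL2Z\<^esub> ?u \<noteq> C"
  have vu: "C #>\<^bsub>PSL2Z\<^esub> ?v #>\<^bsub>PSL2Z\<^esub> ?u = C"
    using C by (simp add: coset_mult PSL2Z.m_assoc psl_u_cube coset_one)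
  have uv: "C #>\<^bsub>PSL2Z\<^esub> ?u #>\<^bsub>PSL2Z\<^esub> ?v = C"
    using C by (simp add: coset_mult psl_u_cube coset_one)
  have uu: "C #>\<^bsub>PSL2Z\<^esub> ?u #>\<^bsub>PSL2Z\<^esub> ?u = C #>\<^bsub>PSL2Z\<^esub> ?v"
    using C by (simp add: coset_mult)
  have "C #>\<^bsub>PSL2Z\<^esub> ?v \<noteq> C" using u vu by metis
  moreover have "C #>\<^bsub>PSL2Z\<^esub> ?v \<noteq> C #>\<^bsub>PSL2Z\<^esub> ?u" using u uu vu by metis
  ultimately have "card (right_orbit G1 C) = 3" using u by (simp add: orbit_G1[OF C])
  with card show False by simp
qed

lemma orbit_image:
  assumes "equivariant G f" "C \<in> cosets" "K \<subseteq> carrier PSL2Z"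
  shows "f ` right_orbit K C = right_orbit K (f C)"
  using assms unfolding equivariant_def right_orbit_def by (auto simp: image_iff subset_iff)

lemma vertex_map_vertex:
  assumes "equivariant G f" "C \<in> cosets"
  shows "vertex_map G f (vertex0 C) = vertex0 (f C)" "vertex_map G f (vertex1 C) = vertex1 (f C)"
proof -
  have "vertex0 C \<in> verts (Y_comb G)" "vertex1 C \<in> verts (Y_comb G)"
    using assms by (auto simp: Y_comb_simps)
  then show "vertex_map G f (vertex0 C) = vertex0 (f C)" "vertex_map G f (vertex1 C) = vertex1 (f C)"
    using assms orbit_image G0_carrier G1_carrier
    by (simp_all add: vertex_map_def vertex0_def vertex1_def)
qed

text \<open>At a vertex of \<open>C\<close> both sides give the vertex of the same type of
  \<open>f (g C)\<close>, and off the vertex set both are \<open>undefined\<close>.\<close>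

lemma vertex_map_compose:
  assumes "equivariant G f" "equivariant G g" "g \<in> cosets \<rightarrow> cosets"
  shows "vertex_map G (compose cosets f g) = compose (verts (Y_comb G)) (vertex_map G f) (vertex_map G g)"
proof
  have eq: "equivariant G (compose cosets f g)"
    using assms by (simp add: equivariant_def compose_def coset_closed Pi_iff)
  fix v
  show "vertex_map G (compose cosets f g) v =
      compose (verts (Y_comb G)) (vertex_map G f) (vertex_map G g) v"
  proof (cases "v \<in> verts (Y_comb G)")
    case True
    then obtain C where C: "C \<in> cosets" "v = vertex0 C \<or> v = vertex1 C" by (auto simp: Y_comb_simps)
    moreover have "g C \<in> cosets" using C assms by auto
    ultimately show ?thesis
      using True assms eq by (auto simp: compose_def vertex_map_vertex)
  qed (simp add: vertex_map_def compose_def)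
qed

section \<open>Graph automorphisms are the equivariant bijections of the edges\<close>

text \<open>Equivariance carries orbits to orbits and commutes with translation by u, so incidence,
  types and cyclic orders are respected; bijectivity on vertices is inherited from
  \<open>f\<close>.\<close>

lemma graph_aut_equivariant:
  assumes f: "f \<in> Bij cosets" and eq: "equivariant G f"
  shows "(f, vertex_map G f) \<in> graph_auts (Y_comb G)"
proof -
  let ?h = "vertex_map G f" and ?V = "verts (Y_comb G)"
  have inj: "inj_on f cosets" and img: "f ` cosets = cosets"
    using f by (auto simp: Bij_def bij_betw_def)
  have fX: "f C \<in> cosets" if "C \<in> cosets" for C using that img by auto
  have orb: "right_orbit K C \<subseteq> cosets" if "C \<in> cosets" "K \<in> {G0, G1}" for K C
    using that orbit_subset G0_carrier G1_carrier by blast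
  have orb_f: "right_orbit K (f C) = f ` right_orbit K C" if "C \<in> cosets" "K \<in> {G0, G1}" for K C
    using that orbit_image[OF eq] G0_carrier G1_carrier by blast
  have "bij_betw ?h ?V ?V"
    unfolding bij_betw_def
  proof
    show "inj_on ?h ?V"
    proof (rule inj_onI)
      fix v w assume v: "v \<in> ?V" "w \<in> ?V" and h: "?h v = ?h w"
      have "snd v \<subseteq> cosets" "snd w \<subseteq> cosets"
        using v by (auto simp: Y_comb_simps vertex0_def vertex1_def dest: orb[THEN subsetD, rotated 2])
      moreover have "fst v = fst w" "f ` snd v = f ` snd w" using v h by (auto simp: vertex_map_def)
      \<comment> \<open>A vertex is its tag and a subset of the cosets, and that subset can be
        recovered from its image under the injective \<open>f\<close>.\<close>
      ultimately show "v = w" using inj_on_image_eq_iff[OF inj] by (auto simp: prod_eq_iff)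
    qed
    have "?h ` ?V = vertex0 ` f ` cosets \<union> vertex1 ` f ` cosets"
      by (simp add: Y_comb_simps image_Un image_image vertex_map_vertex[OF eq] cong: image_cong)
    then show "?h ` ?V = ?V" by (simp add: img Y_comb_simps)
  qed
  then have "?h \<in> Bij ?V" by (simp add: Bij_def vertex_map_def)
  moreover have "fst (?h v) = fst v" if "v \<in> ?V" for v
    using that by (simp add: vertex_map_def)
  moreover have "(a, b, c) \<in> cyc (Y_comb G) v \<longleftrightarrow> (f a, f b, f c) \<in> cyc (Y_comb G) (?h v)"
    if v: "v \<in> ?V" and abc: "a \<in> cosets" "b \<in> cosets" "c \<in> cosets" for v a b c
  proof -
    from v consider C where "C \<in> cosets" "v = vertex0 C" | C where "C \<in> cosets" "v = vertex1 C"
      by (auto simp: Y_comb_simps)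
    then show ?thesis
    proof cases
      case 1
      then show ?thesis by (simp add: vertex_map_vertex[OF eq] cyc_vertex0)
    next
      case 2
      \<comment> \<open>Each condition in \<open>cyc_vertex1\<close> transfers in both directions by
        injectivity of \<open>f\<close>: the size of the orbit, membership in it, and the two
        translation equations.\<close>
      have "card (f ` right_orbit G1 C) = card (right_orbit G1 C)"
        using inj_on_subset[OF inj] orb 2 by (intro card_image) auto
      moreover have "f a \<in> f ` right_orbit G1 C \<longleftrightarrow> a \<in> right_orbit G1 C"
        by (rule inj_on_image_mem_iff[OF inj abc(1) orb]) (simp_all add: 2)
      moreover have "f d = f a #>\<^bsub>PSL2Z\<^esub> g \<longleftrightarrow> d = a #>\<^bsub>PSL2Z\<^esub> g"
        if "g \<in> carrier PSL2Z" "d \<in> cosets" for g d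
        using eq that abc(1) inj_on_eq_iff[OF inj that(2) coset_closed[OF abc(1) that(1)]]
        by (simp add: equivariant_def)
      ultimately show ?thesis
        using 2 abc by (simp add: vertex_map_vertex[OF eq] cyc_vertex1 orb_f)
    qed
  qed
  ultimately show ?thesis
    using f by (auto simp: graph_auts_def Y_comb_simps vertex_map_vertex[OF eq])
qed

text \<open>The converse direction: incidence and types force \<open>h\<close> to follow
  \<open>f\<close>, and then injectivity of \<open>h\<close> and the cyclic orders make
  \<open>f\<close> commute with s and u.\<close>

lemma graph_autsD:
  assumes "(f, h) \<in> graph_auts (Y_comb G)"
  shows "f \<in> Bij cosets" "equivariant G f" "h = vertex_map G f"
proof -
  let ?V = "verts (Y_comb G)"
  show f: "f \<in> Bij cosets" using assms by (simp add: graph_auts_def Y_comb_simps)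
  have h: "h \<in> Bij ?V" using assms by (simp add: graph_auts_def)
  have ends: "{vertex0 (f C), vertex1 (f C)} = {h (vertex0 C), h (vertex1 C)}" if "C \<in> cosets" for C
    using assms that by (simp add: graph_auts_def Y_comb_simps)
  have vtype: "fst (h v) = fst v" if "v \<in> ?V" for v
    using assms that by (simp add: graph_auts_def Y_comb_simps)
  have cyc: "(a, b, c) \<in> cyc (Y_comb G) v \<longleftrightarrow> (f a, f b, f c) \<in> cyc (Y_comb G) (h v)"
    if "v \<in> ?V" "a \<in> cosets" "b \<in> cosets" "c \<in> cosets" for a b c v
    using assms that by (simp add: graph_auts_def Y_comb_simps)
  have V: "vertex0 C \<in> ?V" "vertex1 C \<in> ?V" if "C \<in> cosets" for C
    using that by (auto simp: Y_comb_simps)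
  have h_inj: "h v = h w \<longleftrightarrow> v = w" if "v \<in> ?V" "w \<in> ?V" for v w
    using h that by (auto simp: Bij_def bij_betw_def inj_on_eq_iff)
  have f_img: "f ` cosets = cosets" using f by (auto simp: Bij_def bij_betw_def)
  then have fX: "f C \<in> cosets" if "C \<in> cosets" for C using that by auto
  have h0: "h (vertex0 C) = vertex0 (f C)" and h1: "h (vertex1 C) = vertex1 (f C)"
    if C: "C \<in> cosets" for C
  proof -
    \<comment> \<open>The ends of an edge form an unordered pair; the types exclude that
      \<open>h\<close> exchanges them.\<close>
    have "fst (h (vertex0 C)) \<noteq> fst (vertex1 (f C))" "fst (h (vertex1 C)) \<noteq> fst (vertex0 (f C))"
      using vtype[OF V(1)[OF C]] vtype[OF V(2)[OF C]] by (simp_all add: vertex0_def vertex1_def)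
    then show "h (vertex0 C) = vertex0 (f C)" "h (vertex1 C) = vertex1 (f C)"
      using ends[OF C] by (metis doubleton_eq_iff)+
  qed
  have s: "f (C #>\<^bsub>PSL2Z\<^esub> psl_s) = f C #>\<^bsub>PSL2Z\<^esub> psl_s" if C: "C \<in> cosets" for C
  proof -
    let ?D = "C #>\<^bsub>PSL2Z\<^esub> psl_s"
    have D: "?D \<in> cosets" using C by (simp add: coset_closed)
    have "f C #>\<^bsub>PSL2Z\<^esub> psl_s \<in> f ` cosets" using C fX by (simp add: f_img coset_closed)
    \<comment> \<open>The preimage \<open>E\<close> shares its vertex of type 0 with
      \<open>C\<close>, because their images do and \<open>h\<close> is injective; hence it is
      \<open>C\<close> or \<open>?D\<close>.\<close>
    then obtain E where E: "E \<in> cosets" "f E = f C #>\<^bsub>PSL2Z\<^esub> psl_s" by auto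
    then have "h (vertex0 E) = h (vertex0 C)" using C fX by (simp add: h0 vertex0_act_s)
    then have "E \<in> {C, ?D}" using E C V by (auto simp: h_inj orbit_G0 dest!: vertex0_eqD)
    \<comment> \<open>This decides the case \<open>E = C\<close>: there s fixes \<open>f C\<close>,
      and the set shrinks to a single element.\<close>
    moreover have "f ?D \<in> {f C, f C #>\<^bsub>PSL2Z\<^esub> psl_s}"
    proof -
      have "vertex0 (f ?D) = vertex0 (f C)" using C D by (simp add: h0[symmetric] vertex0_act_s)
      then show ?thesis using vertex0_eqD[OF _ fX[OF D]] orbit_G0[OF fX[OF C]] by blast
    qed
    ultimately show ?thesis using E by auto
  qed
  have u: "f (C #>\<^bsub>PSL2Z\<^esub> psl_u) = f C #>\<^bsub>PSL2Z\<^esub> psl_u" if C: "C \<in> cosets" for C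
  proof (cases "card (right_orbit G1 C) = 3")
    case True
    let ?b = "C #>\<^bsub>PSL2Z\<^esub> psl_u" and ?c = "C #>\<^bsub>PSL2Z\<^esub> (psl_u \<otimes>\<^bsub>PSL2Z\<^esub> psl_u)"
    have "(C, ?b, ?c) \<in> cyc (Y_comb G) (vertex1 C)"
      using True C by (simp add: cyc_vertex1 orbit_G1)
    then have "(f C, f ?b, f ?c) \<in> cyc (Y_comb G) (vertex1 (f C))"
      using cyc[OF V(2)[OF C], of C ?b ?c] C by (simp add: h1 coset_closed)
    then show ?thesis by (simp add: cyc_vertex1)
  next
    case False
    then have Cu: "C #>\<^bsub>PSL2Z\<^esub> psl_u = C" by (rule orbit_G1_degenerate[OF C])
    then have Cuu: "C #>\<^bsub>PSL2Z\<^esub> (psl_u \<otimes>\<^bsub>PSL2Z\<^esub> psl_u) = C"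
      using C by (metis coset_mult psl_u_closed)
    \<comment> \<open>No cyclic order is available at this vertex. Instead, the preimage
      \<open>E\<close> of the translate lies in the orbit of \<open>C\<close>, which is just
      \<open>{C}\<close>.\<close>
    have "f C #>\<^bsub>PSL2Z\<^esub> psl_u \<in> f ` cosets" using C fX by (simp add: f_img coset_closed)
    then obtain E where E: "E \<in> cosets" "f E = f C #>\<^bsub>PSL2Z\<^esub> psl_u" by auto
    then have "h (vertex1 E) = h (vertex1 C)" using C fX by (simp add: h1 vertex1_act_u)
    then have "E = C" using E C V Cu Cuu by (auto simp: h_inj orbit_G1 dest!: vertex1_eqD)
    then show ?thesis using E Cu by simp
  qed
  show eq: "equivariant G f"
    unfolding equivariant_def
  proof (intro ballI)
    fix C g assume C: "C \<in> cosets" and g: "g \<in> carrier PSL2Z"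
    show "f (C #>\<^bsub>PSL2Z\<^esub> g) = f C #>\<^bsub>PSL2Z\<^esub> g"
    proof (rule PSL2Z.equivariant_generate[OF G _ _ _ _ C])
      show "f \<in> cosets \<rightarrow> cosets" using fX by blast
      show "{psl_s, psl_u} \<subseteq> carrier PSL2Z" by simp
      show "g \<in> generate PSL2Z {psl_s, psl_u}" using g by (simp only: PSL2Z_generated)
    qed (use s u in blast)
  qed
  show "h = vertex_map G f"
  proof
    fix v show "h v = vertex_map G f v"
    proof (cases "v \<in> ?V")
      case True
      then show ?thesis by (auto simp: Y_comb_simps h0 h1 vertex_map_vertex[OF eq])
    next
      case False
      then show ?thesis using extensional_arb[OF Bij_imp_extensional[OF h]] by (simp add: vertex_map_def)
    qed
  qed
qed

section \<open>The action of the normaliser quotient on the graph\<close>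

text \<open>As \<open>n\<close> normalises \<open>G\<close>, the coset \<open>Gnx\<close> is the product of the sets \<open>Gn\<close> and \<open>Gx\<close>, so the action
  of \<open>Gn\<close> needs no choice of a representative.\<close>

definition coset_action :: "mat2 set set \<Rightarrow> mat2 set set \<Rightarrow> mat2 set set" where
  "coset_action K = (\<lambda>C\<in>cosets. K <#>\<^bsub>PSL2Z\<^esub> C)"

lemma coset_action_coset:
  assumes "n \<in> normalizer PSL2Z G" "x \<in> carrier PSL2Z"
  shows "coset_action (G #>\<^bsub>PSL2Z\<^esub> n) (G #>\<^bsub>PSL2Z\<^esub> x) = G #>\<^bsub>PSL2Z\<^esub> (n \<otimes>\<^bsub>PSL2Z\<^esub> x)"
  using assms subgroup.subset[OF G]
  by (simp add: coset_action_def PSL2Z.rcosetsI PSL2Z.set_mult_rcoset_normalizer[OF G])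

lemma coset_action_Bij: "n \<in> normalizer PSL2Z G \<Longrightarrow> coset_action (G #>\<^bsub>PSL2Z\<^esub> n) \<in> Bij cosets"
  unfolding coset_action_def by (rule PSL2Z.set_mult_normalizer_Bij[OF G])

lemma coset_action_equivariant:
  assumes n: "n \<in> normalizer PSL2Z G"
  shows "equivariant G (coset_action (G #>\<^bsub>PSL2Z\<^esub> n))"
proof -
  have "n \<in> carrier PSL2Z" using n PSL2Z.normalizer_iff[OF G] by simp
  then show ?thesis
    using n subgroup.subset[OF G]
    by (auto simp: equivariant_def RCOSETS_def PSL2Z.coset_mult_assoc coset_action_coset PSL2Z.m_assoc)
qed

lemma coset_action_mult:
  assumes n: "n \<in> normalizer PSL2Z G" and m: "m \<in> normalizer PSL2Z G"
  shows "coset_action (G #>\<^bsub>PSL2Z\<^esub> n <#>\<^bsub>PSL2Z\<^esub> (G #>\<^bsub>PSL2Z\<^esub> m)) =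
    compose cosets (coset_action (G #>\<^bsub>PSL2Z\<^esub> n)) (coset_action (G #>\<^bsub>PSL2Z\<^esub> m))"
proof
  fix C
  have carr: "n \<in> carrier PSL2Z" "m \<in> carrier PSL2Z"
    using n m PSL2Z.normalizer_iff[OF G] by auto
  have "subgroup (normalizer PSL2Z G) PSL2Z"
    by (rule PSL2Z.normalizer_imp_subgroup[OF subgroup.subset[OF G]])
  then have nm: "n \<otimes>\<^bsub>PSL2Z\<^esub> m \<in> normalizer PSL2Z G" using n m by (rule subgroup.m_closed)
  show "coset_action (G #>\<^bsub>PSL2Z\<^esub> n <#>\<^bsub>PSL2Z\<^esub> (G #>\<^bsub>PSL2Z\<^esub> m)) C =
    compose cosets (coset_action (G #>\<^bsub>PSL2Z\<^esub> n)) (coset_action (G #>\<^bsub>PSL2Z\<^esub> m)) C"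
  proof (cases "C \<in> cosets")
    case True
    then obtain x where "x \<in> carrier PSL2Z" "C = G #>\<^bsub>PSL2Z\<^esub> x" by (auto simp: RCOSETS_def)
    then show ?thesis
      using True nm n m carr
      by (simp add: compose_def PSL2Z.set_mult_rcoset_normalizer[OF G] coset_action_coset PSL2Z.m_assoc)
  qed (simp add: compose_def coset_action_def)
qed

text \<open>Products of sets use only the multiplication, so shrinking the carrier to the normaliser
  changes nothing but the range of the coset representatives.\<close>

lemma normalizer_quotient:
  "carrier (PSL2Z\<lparr>carrier := normalizer PSL2Z G\<rparr> Mod G) =
    (\<lambda>n. G #>\<^bsub>PSL2Z\<^esub> n) ` normalizer PSL2Z G"
  "K \<otimes>\<^bsub>PSL2Z\<lparr>carrier := normalizer PSL2Z G\<rparr> Mod G\<^esub> L = K <#>\<^bsub>PSL2Z\<^esub> L"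
  by (auto simp: FactGroup_def RCOSETS_def r_coset_def set_mult_def)

text \<open>The multiplication of \<open>BijGroup\<close> is a function restricted to
  \<open>Bij\<close>, whence the membership assumptions.\<close>

lemma Aut_Y_comb_simps:
  "carrier (Aut (Y_comb G)) = graph_auts (Y_comb G)"
  "f \<in> Bij cosets \<Longrightarrow> g \<in> Bij cosets \<Longrightarrow> h \<in> Bij (verts (Y_comb G)) \<Longrightarrow> k \<in> Bij (verts (Y_comb G)) \<Longrightarrow>
    (f, h) \<otimes>\<^bsub>Aut (Y_comb G)\<^esub> (g, k) = (compose cosets f g, compose (verts (Y_comb G)) h k)"
  by (simp_all add: Aut_def DirProd_def BijGroup_def Y_comb_simps(2))

text \<open>The image of the trivial coset recovers the element of the quotient, which gives
  injectivity. For surjectivity, \<open>graph_autsD\<close> reduces an automorphism to an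
  equivariant bijection, and \<open>equivariant_Bij_normalizer\<close> supplies the normalising
  element.\<close>

lemma coset_action_iso:
  "(\<lambda>K. (coset_action K, vertex_map G (coset_action K)))
    \<in> iso (PSL2Z\<lparr>carrier := normalizer PSL2Z G\<rparr> Mod G) (Aut (Y_comb G))"
  (is "?\<Phi> \<in> iso ?Q _")
proof (rule isoI)
  have mem: "?\<Phi> (G #>\<^bsub>PSL2Z\<^esub> n) \<in> graph_auts (Y_comb G)" if "n \<in> normalizer PSL2Z G" for n
    using that by (intro graph_aut_equivariant coset_action_Bij coset_action_equivariant)
  show "?\<Phi> \<in> hom ?Q (Aut (Y_comb G))"
  proof (rule homI)
    fix K assume "K \<in> carrier ?Q"
    then show "?\<Phi> K \<in> carrier (Aut (Y_comb G))"
      using mem by (auto simp: normalizer_quotient Aut_Y_comb_simps)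
  next
    fix K L assume "K \<in> carrier ?Q" "L \<in> carrier ?Q"
    then obtain n m where nm: "n \<in> normalizer PSL2Z G" "m \<in> normalizer PSL2Z G"
      "K = G #>\<^bsub>PSL2Z\<^esub> n" "L = G #>\<^bsub>PSL2Z\<^esub> m"
      by (auto simp: normalizer_quotient)
    have "vertex_map G (coset_action K) \<in> Bij (verts (Y_comb G))"
      "vertex_map G (coset_action L) \<in> Bij (verts (Y_comb G))"
      using mem nm by (auto simp: graph_auts_def)
    moreover have "vertex_map G (coset_action (K <#>\<^bsub>PSL2Z\<^esub> L)) =
        compose (verts (Y_comb G)) (vertex_map G (coset_action K)) (vertex_map G (coset_action L))"
      using nm by (simp add: coset_action_mult vertex_map_compose coset_action_equivariant
          Bij_imp_funcset coset_action_Bij)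
    ultimately show "?\<Phi> (K \<otimes>\<^bsub>?Q\<^esub> L) = ?\<Phi> K \<otimes>\<^bsub>Aut (Y_comb G)\<^esub> ?\<Phi> L"
      using nm by (simp add: normalizer_quotient Aut_Y_comb_simps coset_action_Bij coset_action_mult)
  qed
  show "bij_betw ?\<Phi> (carrier ?Q) (carrier (Aut (Y_comb G)))"
    unfolding bij_betw_def
  proof
    show "inj_on ?\<Phi> (carrier ?Q)"
    proof (rule inj_onI)
      fix K L assume "K \<in> carrier ?Q" "L \<in> carrier ?Q" and e: "?\<Phi> K = ?\<Phi> L"
      then obtain n m where nm: "n \<in> normalizer PSL2Z G" "m \<in> normalizer PSL2Z G"
        "K = G #>\<^bsub>PSL2Z\<^esub> n" "L = G #>\<^bsub>PSL2Z\<^esub> m"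
        by (auto simp: normalizer_quotient)
      \<comment> \<open>Evaluated at the coset of the identity, \<open>coset_action K\<close>
        returns \<open>K\<close> itself.\<close>
      have "coset_action K (G #>\<^bsub>PSL2Z\<^esub> \<one>\<^bsub>PSL2Z\<^esub>) = coset_action L (G #>\<^bsub>PSL2Z\<^esub> \<one>\<^bsub>PSL2Z\<^esub>)"
        using e by simp
      then show "K = L"
        using nm PSL2Z.normalizer_iff[OF G] by (simp add: coset_action_coset)
    qed
    show "?\<Phi> ` carrier ?Q = carrier (Aut (Y_comb G))"
    proof (intro equalityI subsetI)
      fix p assume "p \<in> ?\<Phi> ` carrier ?Q"
      then show "p \<in> carrier (Aut (Y_comb G))"
        using mem by (auto simp: normalizer_quotient Aut_Y_comb_simps)
    next
      fix p assume "p \<in> carrier (Aut (Y_comb G))"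
      then obtain f h where p: "p = (f, h)" "(f, h) \<in> graph_auts (Y_comb G)"
        by (cases p) (auto simp: Aut_Y_comb_simps)
      note f = graph_autsD[OF p(2)]
      obtain n where n: "n \<in> normalizer PSL2Z G"
        "\<And>x. x \<in> carrier PSL2Z \<Longrightarrow> f (G #>\<^bsub>PSL2Z\<^esub> x) = G #>\<^bsub>PSL2Z\<^esub> (n \<otimes>\<^bsub>PSL2Z\<^esub> x)"
        by (rule PSL2Z.equivariant_Bij_normalizer[OF G f(1)]) (use f(2) in \<open>auto simp: equivariant_def\<close>)
      \<comment> \<open>Both maps are extensional, so agreement on the cosets suffices; the vertex
        component then agrees because it is computed from \<open>f\<close>.\<close>
      have "f = coset_action (G #>\<^bsub>PSL2Z\<^esub> n)"
      proof (rule extensionalityI)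
        show "f \<in> extensional cosets" using f(1) by (rule Bij_imp_extensional)
        show "coset_action (G #>\<^bsub>PSL2Z\<^esub> n) \<in> extensional cosets" by (simp add: coset_action_def)
      next
        fix C assume "C \<in> cosets"
        then show "f C = coset_action (G #>\<^bsub>PSL2Z\<^esub> n) C"
          using n by (auto simp: RCOSETS_def coset_action_coset)
      qed
      then show "p \<in> ?\<Phi> ` carrier ?Q" using n(1) f(3) p(1) by (auto simp: normalizer_quotient)
    qed
  qed
qed

end

text \<open>The formulas on edges and on both types of vertices pin \<open>\<Phi>\<close> down as
  the map induced by the action of the normaliser, so more than an abstract isomorphism is
  obtained.\<close>

theorem proposition4p2:
  fixes G :: "mat2 set set"
  assumes "subgroup G PSL2Z"
  shows "\<exists>\<Phi> \<in> iso (PSL2Z\<lparr>carrier := normalizer PSL2Z G\<rparr> Mod G) (Aut (Y_comb G)).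
    \<forall>n \<in> normalizer PSL2Z G. \<forall>x \<in> carrier PSL2Z.
      fst (\<Phi> (G #>\<^bsub>PSL2Z\<^esub> n)) (G #>\<^bsub>PSL2Z\<^esub> x) = G #>\<^bsub>PSL2Z\<^esub> (n \<otimes>\<^bsub>PSL2Z\<^esub> x) \<and>
      snd (\<Phi> (G #>\<^bsub>PSL2Z\<^esub> n)) (vertex0 (G #>\<^bsub>PSL2Z\<^esub> x)) = vertex0 (G #>\<^bsub>PSL2Z\<^esub> (n \<otimes>\<^bsub>PSL2Z\<^esub> x)) \<and>
      snd (\<Phi> (G #>\<^bsub>PSL2Z\<^esub> n)) (vertex1 (G #>\<^bsub>PSL2Z\<^esub> x)) = vertex1 (G #>\<^bsub>PSL2Z\<^esub> (n \<otimes>\<^bsub>PSL2Z\<^esub> x))"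
proof (rule bexI[OF _ coset_action_iso[OF assms]], intro ballI)
  fix n x assume n: "n \<in> normalizer PSL2Z G" and x: "x \<in> carrier PSL2Z"
  let ?f = "coset_action G (G #>\<^bsub>PSL2Z\<^esub> n)"
  have "G #>\<^bsub>PSL2Z\<^esub> x \<in> rcosets\<^bsub>PSL2Z\<^esub> G"
    using subgroup.subset[OF assms] x by (rule PSL2Z.rcosetsI)
  note * = coset_action_coset[OF assms n x]
    vertex_map_vertex[OF assms coset_action_equivariant[OF assms n] this]
  show "fst (?f, vertex_map G ?f) (G #>\<^bsub>PSL2Z\<^esub> x) = G #>\<^bsub>PSL2Z\<^esub> (n \<otimes>\<^bsub>PSL2Z\<^esub> x) \<and>
      snd (?f, vertex_map G ?f) (vertex0 (G #>\<^bsub>PSL2Z\<^esub> x)) = vertex0 (G #>\<^bsub>PSL2Z\<^esub> (n \<otimes>\<^bsub>PSL2Z\<^esub> x)) \<and>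
      snd (?f, vertex_map G ?f) (vertex1 (G #>\<^bsub>PSL2Z\<^esub> x)) = vertex1 (G #>\<^bsub>PSL2Z\<^esub> (n \<otimes>\<^bsub>PSL2Z\<^esub> x))"
    by (simp add: *)
qed

end
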